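(* Let $w\in\mathcal{M}$ with $H_{NE}(w,z)=\sum_{i\in\mathbb{Z}}a_iz^i$ and $H_{SE}(w,z)=\sum_{i\in\mathbb{Z}}b_iz^i$. Then the number of words $u\in\mathcal{M}$ with $u\overset{\mathrm{bal}}{\sim}w$ equals $$\prod_{i\ge0}\binom{a_i+b_{i+2}-1}{b_{i+2}}\binom{b_{-i}+a_{-i-2}-1}{a_{-i-2}}\times\begin{cases}\binom{a_0+b_0}{a_0}, & w \text{ balanced},\\ \binom{a_0+b_0-1}{b_0}, & w\text{ rising and not balanced},\\ \binom{a_0+b_0-1}{a_0}, & w\text{ falling and not balanced}.\end{cases}$$
   Context: $\mathcal{M}$ is the free monoid on letters $D,U$. For $w=w_1\cdots w_N$ and $0\le i\le N$ let $h_i=(\#U\text{'s}-\#D\text{'s in }w_1\cdots w_i)$. $H_{NE}(w,z)=\sum_{0\le i<N,\,w_{i+1}=U}z^{h_i}$ and $H_{SE}(w,z)=\sum_{0\le i<N,\,w_{i+1}=D}z^{h_i}$ (Laurent polynomials, so $a_i=b_i=0$ for all but finitely many $i$). A word is balanced / rising / falling if it has equally many / at least as many $U$'s as $D$'s / at least as many $D$'s as $U$'s. A balanced commutation turns $pyxq$ into $pxyq$ for words $p,q$ and balanced words $x,y$; $\overset{\mathrm{bal}}{\sim}$ is the equivalence relation generated by balanced commutations. Binomial coefficients are the usual ones with $\binom{-1}{0}=1$. *)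

theory Defs
  imports Complex_Main "HOL-Library.Poly_Mapping"
begin

datatype letter = D | U

type_synonym word = "letter list"

definition height :: "word \<Rightarrow> nat \<Rightarrow> int" where
  "height w i = int (count_list (take i w) U) - int (count_list (take i w) D)"

definition balanced :: "word \<Rightarrow> bool" where
  "balanced w \<longleftrightarrow> count_list w U = count_list w D"

definition rising :: "word \<Rightarrow> bool" where
  "rising w \<longleftrightarrow> count_list w D \<le> count_list w U"

definition falling :: "word \<Rightarrow> bool" where
  "falling w \<longleftrightarrow> count_list w U \<le> count_list w D"

lemma not_rising: "\<not> rising w \<longleftrightarrow> falling w \<and> \<not> balanced w"
  by (auto simp: rising_def falling_def balanced_def)

text \<open>
  Laurent polynomials in \<open>z\<close> with natural coefficients are the finitely supported maps
  \<open>int \<Rightarrow>\<^sub>0 nat\<close>: the monomial \<open>z\<close> to the power \<open>k\<close> is \<open>Poly_Mapping.single k 1\<close>, and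
  \<open>Poly_Mapping.lookup p k\<close> is its coefficient in \<open>p\<close>. The letter \<open>w\<^sub>i\<^sub>+\<^sub>1\<close> of a word is \<open>w ! i\<close>, so it
  contributes the height from which its step starts.
\<close>

definition H_NE :: "word \<Rightarrow> int \<Rightarrow>\<^sub>0 nat" where
  "H_NE w = (\<Sum>i | i < length w \<and> w ! i = U. Poly_Mapping.single (height w i) 1)"

definition H_SE :: "word \<Rightarrow> int \<Rightarrow>\<^sub>0 nat" where
  "H_SE w = (\<Sum>i | i < length w \<and> w ! i = D. Poly_Mapping.single (height w i) 1)"

inductive bal_comm :: "word \<Rightarrow> word \<Rightarrow> bool" where
  "balanced x \<Longrightarrow> balanced y \<Longrightarrow> bal_comm (p @ y @ x @ q) (p @ x @ y @ q)"

definition bal_equiv :: "word \<Rightarrow> word \<Rightarrow> bool"  (infix "\<sim>bal" 50) where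
  "bal_equiv = equivclp bal_comm"

lemma bal_equiv_length:
  assumes "u \<sim>bal w"
  shows "length u = length w"
  using assms unfolding bal_equiv_def
  by (induction rule: equivclp_induct) (auto elim: bal_comm.cases)

lemma finite_bal_class: "finite {u. u \<sim>bal w}"
proof (rule finite_subset)
  have "(x :: letter) \<in> {D, U}" for x
    by (cases x) auto
  then show "{u. u \<sim>bal w} \<subseteq> {u. set u \<subseteq> {D, U} \<and> length u = length w}"
    by (auto dest: bal_equiv_length)
  show "finite {u. set u \<subseteq> {D, U} \<and> length u = length w}"
    by (rule finite_lists_length_eq) simp
qed

text \<open>
  Binomial coefficients are taken over \<open>rat\<close>, so that \<open>(- 1) gchoose 0 = 1\<close> and no
  truncated subtraction occurs.
\<close>

definition side_factor :: "(int \<Rightarrow> nat) \<Rightarrow> (int \<Rightarrow> nat) \<Rightarrow> nat \<Rightarrow> rat" where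
  "side_factor a b i =
     ((of_nat (a (int i)) + of_nat (b (int i + 2)) - 1) gchoose b (int i + 2)) *
     ((of_nat (b (- int i)) + of_nat (a (- int i - 2)) - 1) gchoose a (- int i - 2))"

text \<open>
  Only finitely many factors differ from \<open>1\<close>, so the infinite product over \<open>i \<ge> 0\<close> can be
  written with \<open>Prod_any\<close>, which is \<open>1\<close> by convention when the support is infinite.
\<close>

lemma finite_side_factor_support:
  fixes p q :: "int \<Rightarrow>\<^sub>0 nat"
  shows "finite {i. side_factor (Poly_Mapping.lookup p) (Poly_Mapping.lookup q) i \<noteq> 1}"
proof (rule finite_subset)
  show "{i. side_factor (Poly_Mapping.lookup p) (Poly_Mapping.lookup q) i \<noteq> 1} \<subseteq>
    (\<lambda>k. nat (k - 2)) ` {k. Poly_Mapping.lookup q k \<noteq> 0} \<union> (\<lambda>k. nat (- k - 2)) ` {k. Poly_Mapping.lookup p k \<noteq> 0}"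
  proof
    fix i assume "i \<in> {i. side_factor (Poly_Mapping.lookup p) (Poly_Mapping.lookup q) i \<noteq> 1}"
    then have "Poly_Mapping.lookup q (int i + 2) \<noteq> 0 \<or> Poly_Mapping.lookup p (- int i - 2) \<noteq> 0"
      by - (rule ccontr, simp add: side_factor_def)
    moreover have "i = nat ((int i + 2) - 2)" "i = nat (- (- int i - 2) - 2)"
      by auto
    ultimately show "i \<in> (\<lambda>k. nat (k - 2)) ` {k. Poly_Mapping.lookup q k \<noteq> 0} \<union>
      (\<lambda>k. nat (- k - 2)) ` {k. Poly_Mapping.lookup p k \<noteq> 0}"
      by blast
  qed
qed (intro finite_UnI finite_imageI; simp)

end

theory Submission
  imports Defs
begin

text \<open>
  Read a word as a walk on the integers. Balanced commutations preserve, for every height, the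
  numbers of up-steps and down-steps leaving it. Conversely, two words with the same exit numbers
  are equivalent: if their first letters differ, then in one of them an excursion starting with the
  other letter can be commuted to the front, and one cancels the common first letter.

  Hence the class is the set of Eulerian trails of a multigraph on the integer line. If the trail
  ends at height \<open>e\<close>, the last exit from every other visited height is the one towards \<open>e\<close>, and all
  other exits can be ordered arbitrarily; this gives one binomial coefficient per height. The
  resulting product satisfies, by Pascal's rule at the starting height, the same recursion as
  the number of trails.
\<close>

section \<open>Walks, exit numbers and the coefficients of the two Laurent polynomials\<close>

primrec step :: "letter \<Rightarrow> int" where
  "step U = 1"
| "step D = - 1"

definition rise :: "word \<Rightarrow> int" where
  "rise u = sum_list (map step u)"

text \<open>The start height \<open>s\<close> is a parameter so that inductions can strip the first
  letter; the coefficients in the theorem are the case \<open>s = 0\<close>.\<close>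

primrec exits :: "letter \<Rightarrow> int \<Rightarrow> word \<Rightarrow> int \<Rightarrow> nat" where
  "exits c s [] i = 0"
| "exits c s (x # u) i = of_bool (x = c \<and> s = i) + exits c (s + step x) u i"

lemma rise_simps [simp]:
  "rise [] = 0" "rise (x # u) = step x + rise u" "rise (u @ v) = rise u + rise v"
  by (simp_all add: rise_def)

lemma rise_conv_count_list: "rise u = int (count_list u U) - int (count_list u D)"
proof (induction u)
  case (Cons x u)
  then show ?case by (cases x) auto
qed simp

lemma height_conv_rise: "height u i = rise (take i u)"
  by (simp add: height_def rise_conv_count_list)

lemma balanced_iff_rise: "balanced u \<longleftrightarrow> rise u = 0"
  by (auto simp: balanced_def rise_conv_count_list)

lemma rising_iff_rise: "rising u \<longleftrightarrow> 0 \<le> rise u"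
  by (auto simp: rising_def rise_conv_count_list)

lemma step_other: "c \<noteq> d \<Longrightarrow> step d = - step c"
  by (cases c; cases d) auto

lemma step_square: "step c * step c = 1"
  by (cases c) auto

lemma exits_append: "exits c s (u @ v) i = exits c s u i + exits c (s + rise u) v i"
  by (induction u arbitrary: s) (auto simp: add.assoc)

lemma exits_conv_sum:
  "exits c s u k = (\<Sum>i<length u. of_bool (u ! i = c \<and> s + height u i = k))"
proof (induction u arbitrary: s)
  case (Cons x u)
  show ?case
    by (simp add: Cons.IH sum.lessThan_Suc_shift height_conv_rise add.assoc del: sum.lessThan_Suc)
qed simp

lemma lookup_sum_single:
  assumes "finite I"
  shows "Poly_Mapping.lookup (\<Sum>i\<in>I. Poly_Mapping.single (h i) (1::nat)) k = (\<Sum>i\<in>I. of_bool (h i = k))"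
  using assms by (induction I rule: finite_induct) (auto simp: lookup_add lookup_single when_def)

lemma lookup_steps_eq_exits:
  "Poly_Mapping.lookup (\<Sum>i | i < length w \<and> w ! i = c. Poly_Mapping.single (height w i) 1) k
    = exits c 0 w k"
proof -
  have "Poly_Mapping.lookup (\<Sum>i | i < length w \<and> w ! i = c. Poly_Mapping.single (height w i) (1::nat)) k
      = (\<Sum>i | i < length w \<and> w ! i = c. of_bool (height w i = k))"
    by (rule lookup_sum_single) simp
  also have "\<dots>
      = (\<Sum>i\<in>{..<length w}. of_bool (w ! i = c \<and> height w i = k) :: nat)"
    by (rule sum.mono_neutral_cong_left) auto
  finally show ?thesis
    by (simp only: exits_conv_sum add_0)
qed

lemma lookup_H_NE: "Poly_Mapping.lookup (H_NE w) = exits U 0 w"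
  unfolding H_NE_def by (rule ext) (rule lookup_steps_eq_exits)

lemma lookup_H_SE: "Poly_Mapping.lookup (H_SE w) = exits D 0 w"
  unfolding H_SE_def by (rule ext) (rule lookup_steps_eq_exits)

text \<open>Every letter is exactly one exit. A common superset \<open>I\<close> of the supports
  lets two words be compared over the same index set.\<close>

lemma sum_exits:
  assumes "finite I" "\<And>i. exits U s u i \<noteq> 0 \<Longrightarrow> i \<in> I" "\<And>i. exits D s u i \<noteq> 0 \<Longrightarrow> i \<in> I"
  shows "(\<Sum>i\<in>I. exits U s u i + exits D s u i) = length u"
  using assms
proof (induction u arbitrary: s)
  case (Cons x u)
  have "s \<in> I"
    using Cons.prems(2)[of s] Cons.prems(3)[of s] by (cases x) auto
  have "(\<Sum>i\<in>I. exits U s (x # u) i + exits D s (x # u) i)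
      = (\<Sum>i\<in>I. of_bool (s = i) + (exits U (s + step x) u i + exits D (s + step x) u i))"
    by (rule sum.cong) (cases x; simp)+
  also have "\<dots> = 1 + length u"
    using Cons.prems Cons.IH[of "s + step x"] \<open>s \<in> I\<close>
    by (simp add: sum.distrib sum.delta')
  finally show ?case by simp
qed simp

lemma finite_exits: "finite {i. exits c s u i \<noteq> 0}"
proof (induction u arbitrary: s)
  case (Cons x u)
  have "{i. exits c s (x # u) i \<noteq> 0} \<subseteq> insert s {i. exits c (s + step x) u i \<noteq> 0}"
    by auto
  then show ?case
    using Cons.IH by (meson finite.insertI finite_subset)
qed simp

lemma length_eq_if_exits_eq:
  assumes "\<And>c. exits c s u = exits c s v"
  shows "length u = length v"
proof -
  let ?I = "{i. exits U s u i \<noteq> 0} \<union> {i. exits D s u i \<noteq> 0}"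
  have "finite ?I" by (intro finite_UnI finite_exits)
  then show ?thesis
    using sum_exits[of ?I s u] sum_exits[of ?I s v] assms by auto
qed

text \<open>
  \<open>A i\<close> and \<open>B (i + 1)\<close> are the numbers of upward and downward crossings of the edge between \<open>i\<close>
  and \<open>i + 1\<close>; their difference is determined by the endpoints \<open>s\<close> and \<open>e\<close> of the walk.
\<close>

definition cut :: "(int \<Rightarrow> nat) \<Rightarrow> (int \<Rightarrow> nat) \<Rightarrow> int \<Rightarrow> int \<Rightarrow> bool" where
  "cut A B s e \<longleftrightarrow>
    (\<forall>i. int (A i) - int (B (i + 1)) = of_bool (s \<le> i \<and> i < e) - of_bool (e \<le> i \<and> i < s))"

lemma cut_exits: "cut (exits U s u) (exits D s u) s (s + rise u)"
proof (induction u arbitrary: s)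
  case (Cons x u)
  show ?case
    unfolding cut_def
  proof
    fix i
    show "int (exits U s (x # u) i) - int (exits D s (x # u) (i + 1))
      = of_bool (s \<le> i \<and> i < s + rise (x # u)) - of_bool (s + rise (x # u) \<le> i \<and> i < s)"
      using Cons.IH[of "s + step x", unfolded cut_def, rule_format, of i]
      by (cases x) (auto simp: of_bool_def split: if_splits)
  qed
qed (simp add: cut_def)

text \<open>For ends \<open>e < e'\<close>, the two prescribed net crossings of the edge above
  \<open>e\<close> differ by one.\<close>

lemma cut_end_unique:
  assumes "cut A B s e" "cut A B s e'"
  shows "e = e'"
proof -
  have "\<not> e < e'" if "cut A B s e" "cut A B s e'" for e e'
    using that[unfolded cut_def, rule_format, of e] by (auto simp: of_bool_def split: if_splits)
  with assms show ?thesis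
    by (meson linorder_cases)
qed

lemma rise_eq_if_exits_eq:
  assumes "\<And>c. exits c s u = exits c s v"
  shows "rise u = rise v"
  using cut_end_unique[OF cut_exits[of s u]] cut_exits[of s v] assms by fastforce

section \<open>Balanced equivalence and exit numbers\<close>

text \<open>A balanced factor returns to its starting height, so swapping two adjacent ones shifts
  no letter to another height.\<close>

lemma exits_bal_equiv:
  assumes "u \<sim>bal w"
  shows "exits c s u = exits c s w"
proof -
  have "exits c s u = exits c s v" if "bal_comm u v" for u v
    using that by cases (auto simp: fun_eq_iff exits_append balanced_iff_rise)
  with assms show ?thesis
    unfolding bal_equiv_def by (induction rule: equivclp_induct) auto
qed

lemma bal_equiv_refl: "u \<sim>bal u"
  by (simp add: bal_equiv_def)

lemma bal_equiv_sym: "u \<sim>bal v \<Longrightarrow> v \<sim>bal u"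
  unfolding bal_equiv_def by (rule equivclp_sym)

lemma bal_equiv_trans: "u \<sim>bal v \<Longrightarrow> v \<sim>bal w \<Longrightarrow> u \<sim>bal w"
  unfolding bal_equiv_def by (rule equivclp_trans)

lemma bal_equiv_commute:
  "balanced x \<Longrightarrow> balanced y \<Longrightarrow> x @ y @ q \<sim>bal y @ x @ q"
  unfolding bal_equiv_def using bal_comm.intros[of y x "[]" q] by auto

lemma bal_equiv_Cons:
  assumes "u \<sim>bal v"
  shows "c # u \<sim>bal c # v"
proof -
  have *: "bal_comm (c # u) (c # v)" if "bal_comm u v" for u v
    using that bal_comm.intros[where p = "c # p" for p] by cases auto
  from assms show ?thesis
    unfolding bal_equiv_def
  proof (induction rule: equivclp_induct)
    case (step y z)
    then have "equivclp bal_comm (c # y) (c # z)"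
      using * by (auto intro: r_into_equivclp equivclp_sym)
    with step.IH show ?case by (rule equivclp_trans)
  qed simp
qed

lemma exit_decomp:
  assumes "exits c s u i > 0"
  obtains p q where "u = p @ c # q" "s + rise p = i"
  using assms
proof (induction u arbitrary: s thesis)
  case (Cons x u)
  show ?case
  proof (cases "x = c \<and> s = i")
    case True
    then show ?thesis using Cons.prems(1)[of "[]" u] by simp
  next
    case False
    then have "exits c (s + step x) u i > 0"
      using Cons.prems by auto
    then obtain p q where "u = p @ c # q" "s + step x + rise p = i"
      using Cons.IH by blast
    then show ?thesis
      using Cons.prems(1)[of "x # p" q] by simp
  qed
qed simp

text \<open>A discrete intermediate value theorem: steps have size one. The factor
  \<open>step c\<close> covers both directions at once.\<close>

lemma prefix_rise:
  assumes "0 \<le> k" "k \<le> step c * rise q"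
  obtains y r where "q = y @ r" "step c * rise y = k"
  using assms
proof (induction q arbitrary: thesis rule: rev_induct)
  case (snoc x q)
  show ?case
  proof (cases "k \<le> step c * rise q")
    case True
    then show ?thesis
      using snoc.IH snoc.prems by (metis append.assoc)
  next
    case False
    with snoc.prems(3) have "step c * rise (q @ [x]) = k"
      by (cases x; cases c) auto
    then show ?thesis
      using snoc.prems(1)[of "q @ [x]" "[]"] by simp
  qed
qed simp

text \<open>The walk does not end on the side of \<open>s\<close> to which \<open>c\<close> leads,
  so after an exit by \<open>c\<close> from \<open>s\<close> it must come back. This excursion and
  the prefix before it are both balanced and can be swapped.\<close>

lemma bal_equiv_bring_to_front:
  assumes "exits c s u s > 0" "step c * rise u \<le> 0"
  obtains r where "u \<sim>bal c # r"
proof -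
  obtain p q where u: "u = p @ c # q" and p: "rise p = 0"
    using exit_decomp[OF assms(1)] by (metis add_cancel_right_right)
  obtain d where d: "step d = - step c"
    using step.simps by (metis letter.exhaust minus_minus)
  have "1 \<le> step d * rise q"
    using assms(2) u p d step_square[of c] by (simp add: algebra_simps)
  then obtain y r where q: "q = y @ r" and "step d * rise y = 1"
    using prefix_rise[of 1 d q] by auto
  then have "rise y = - step c"
    using d by (cases c) auto
  then have "p @ (c # y) @ r \<sim>bal (c # y) @ p @ r"
    using p by (intro bal_equiv_commute) (simp_all add: balanced_iff_rise)
  then show ?thesis
    using that u q by simp
qed

lemma bal_equiv_if_exits_eq:
  assumes "\<And>c. exits c s u = exits c s w"
  shows "u \<sim>bal w"
  using assms
proof (induction "length u" arbitrary: s u w)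
  case 0
  then have "u = []" "w = []"
    using length_eq_if_exits_eq[OF "0.prems"] by simp_all
  then show ?case
    by (simp add: bal_equiv_refl)
next
  case (Suc n)
  have same_head: "c # u' \<sim>bal c # w'"
    if "length u' = n" "\<And>d. exits d s (c # u') = exits d s (c # w')" for c u' w'
  proof (rule bal_equiv_Cons, rule Suc.hyps(1))
    show "n = length u'" using that(1) by simp
    show "exits d (s + step c) u' = exits d (s + step c) w'" for d
      using that(2)[of d] by (simp add: fun_eq_iff)
  qed
  obtain c u' where u: "u = c # u'" and u': "length u' = n"
    using Suc.hyps(2) by (metis length_Suc_conv)
  have "length w = Suc n"
    using length_eq_if_exits_eq[OF Suc.prems] Suc.hyps(2) by simp
  then obtain d w' where w: "w = d # w'" and w': "length w' = n"
    by (metis length_Suc_conv)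
  have r: "rise w = rise u"
    using rise_eq_if_exits_eq[of s w u] Suc.prems by simp
  show ?case
  proof (cases "c = d")
    case True
    have "c # u' \<sim>bal c # w'"
      using u' by (rule same_head) (use Suc.prems u w True in simp)
    then show ?thesis
      by (simp add: u w True)
  next
    case False
    have d_pos: "exits d s u s > 0"
      by (simp add: Suc.prems w)
    have c_pos: "exits c s w s > 0"
      by (simp add: Suc.prems [symmetric] u)
    show ?thesis
    \<comment> \<open>The letters are opposite and the rises agree, so either \<open>d\<close> can
      be brought to the front of \<open>u\<close> or \<open>c\<close> to the front of
      \<open>w\<close>.\<close>
    proof (cases "step d * rise u \<le> 0")
      case True
      then obtain r where r: "u \<sim>bal d # r"
        using bal_equiv_bring_to_front d_pos by blast
      have "d # r \<sim>bal w"
        unfolding w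
      proof (rule same_head)
        show "length r = n"
          using bal_equiv_length[OF r] u u' by simp
        show "exits e s (d # r) = exits e s (d # w')" for e
          by (simp add: exits_bal_equiv [OF r, symmetric] Suc.prems w)
      qed
      with r show ?thesis by (rule bal_equiv_trans)
    next
      case False
      then have "step c * rise w \<le> 0"
        using step_other[OF \<open>c \<noteq> d\<close>] r by auto
      then obtain r where r: "w \<sim>bal c # r"
        using bal_equiv_bring_to_front c_pos by blast
      have "u \<sim>bal c # r"
        unfolding u
      proof (rule same_head)
        show "length u' = n" by (fact u')
        show "exits e s (c # u') = exits e s (c # r)" for e
          by (simp add: exits_bal_equiv [OF r, symmetric] Suc.prems [symmetric] u)
      qed
      with bal_equiv_sym[OF r] show ?thesis by (rule bal_equiv_trans[rotated])
    qed
  qed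
qed

section \<open>Counting walks with given exit numbers\<close>

text \<open>No end height is needed as a parameter: the start and the exit numbers determine
  it.\<close>

definition walks :: "(int \<Rightarrow> nat) \<Rightarrow> (int \<Rightarrow> nat) \<Rightarrow> int \<Rightarrow> word set" where
  "walks A B s = {u. exits U s u = A \<and> exits D s u = B}"

text \<open>
  The number of orders in which \<open>p\<close> up-exits and \<open>q\<close> down-exits can leave height \<open>i\<close> if the walk
  ends at \<open>e\<close>; for \<open>i \<noteq> e\<close> the last exit is prescribed.
\<close>

definition orders :: "int \<Rightarrow> int \<Rightarrow> nat \<Rightarrow> nat \<Rightarrow> rat" where
  "orders e i p q =
    (if i = e then (of_nat p + of_nat q) gchoose p
     else if i < e then (of_nat p + of_nat q - 1) gchoose q
     else (of_nat p + of_nat q - 1) gchoose p)"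

lemma orders_0_0 [simp]: "orders e i 0 0 = 1"
  by (simp add: orders_def)

lemma gchoose_swap: "((of_nat p + of_nat q) :: rat) gchoose p = (of_nat p + of_nat q) gchoose q"
proof -
  have "(p + q) choose p = (p + q) choose q"
    using binomial_symmetric[of p "p + q"] by simp
  then show ?thesis
    by (metis binomial_gbinomial of_nat_add)
qed

lemma gchoose_pred_0: "0 < n \<Longrightarrow> (of_nat n - 1 :: rat) gchoose n = 0"
  by (cases n) (simp_all flip: binomial_gbinomial)

text \<open>For \<open>p = 1\<close> the first summand is \<open>(q - 1) gchoose q\<close>, which is
  0 for positive \<open>q\<close> and, by the convention for -1 over 0, is 1 for
  \<open>q = 0\<close>.\<close>

lemma pascal:
  assumes "0 < p"
  shows "((of_nat p + of_nat q - 1) :: rat) gchoose q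
    = ((of_nat (p - 1) + of_nat q - 1) gchoose q)
      + (if 0 < q then (of_nat p + of_nat (q - 1) - 1) gchoose (q - 1) else 0)"
proof (cases q)
  case (Suc k)
  obtain m where "p = Suc m" using assms by (cases p) auto
  with Suc show ?thesis
    using gbinomial_Suc_Suc[of "of_nat m + of_nat k :: rat" k] by (simp add: add.commute)
qed simp

text \<open>Split by the direction of the first exit from \<open>i\<close>. The last two hypotheses
  guarantee that the prescribed last exit is available.\<close>

lemma orders_Pascal:
  assumes "0 < p \<or> 0 < q" "i < e \<Longrightarrow> 0 < p" "e < i \<Longrightarrow> 0 < q"
  shows "orders e i p q = (if 0 < p then orders e i (p - 1) q else 0)
    + (if 0 < q then orders e i p (q - 1) else 0)"
proof -
  consider "i < e" | "e < i" | "i = e" by linarith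
  then show ?thesis
  proof cases
    case 1
    then show ?thesis using assms pascal[of p q] by (simp add: orders_def)
  next
    case 2
    then show ?thesis using assms pascal[of q p] by (simp add: orders_def add.commute)
  next
    case 3
    show ?thesis
    proof (cases "p = 0 \<or> q = 0")
      case True
      then show ?thesis
        using 3 assms(1) gchoose_swap[of p 0] gchoose_swap[of "p - 1" 0] by (auto simp: orders_def)
    next
      case False
      then obtain m k where "p = Suc m" "q = Suc k"
        by (metis not0_implies_Suc)
      with 3 show ?thesis
        using gbinomial_Suc_Suc[of "of_nat m + of_nat k + 1 :: rat" m]
        by (simp add: orders_def algebra_simps)
    qed
  qed
qed

text \<open>The edge at \<open>s\<close> towards \<open>e\<close> has net crossing one in that
  direction, so an exit along it exists.\<close>

lemma cut_start:
  assumes "cut A B s e"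
  shows "s < e \<Longrightarrow> 0 < A s" "e < s \<Longrightarrow> 0 < B s"
  using assms[unfolded cut_def, rule_format, of s] assms[unfolded cut_def, rule_format, of "s - 1"]
  by auto

lemma cut_up:
  assumes "cut A B s e" "0 < A s"
  shows "cut (A(s := A s - 1)) B (s + 1) e"
  unfolding cut_def
proof
  fix i
  show "int ((A(s := A s - 1)) i) - int (B (i + 1)) = of_bool (s + 1 \<le> i \<and> i < e) - of_bool (e \<le> i \<and> i < s + 1)"
    using assms(1)[unfolded cut_def, rule_format, of i] assms(2)
    by (auto simp: of_bool_def of_nat_diff split: if_splits)
qed

lemma cut_down:
  assumes "cut A B s e" "0 < B s"
  shows "cut A (B(s := B s - 1)) (s - 1) e"
  unfolding cut_def
proof
  fix i
  show "int (A i) - int ((B(s := B s - 1)) (i + 1)) = of_bool (s - 1 \<le> i \<and> i < e) - of_bool (e \<le> i \<and> i < s - 1)"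
    using assms(1)[unfolded cut_def, rule_format, of i] assms(2)
    by (auto simp: of_bool_def of_nat_diff split: if_splits)
qed

text \<open>
  A trail stuck at its end that leaves edges unused is impossible: the unused edges closest to \<open>e\<close>
  would lead away from it for good.
\<close>

lemma prod_orders_stuck:
  assumes "cut A B e e" "finite I" "\<And>i. A i \<noteq> 0 \<or> B i \<noteq> 0 \<Longrightarrow> i \<in> I"
    and "A e = 0" "B e = 0" "A j \<noteq> 0 \<or> B j \<noteq> 0"
  shows "(\<Prod>i\<in>I. orders e i (A i) (B i)) = 0"
proof (rule ccontr)
  assume "(\<Prod>i\<in>I. orders e i (A i) (B i)) \<noteq> 0"
  moreover have "A i = 0 \<and> B i = 0" if "i \<notin> I" for i
    using assms(3) that by blast
  ultimately have nz: "orders e i (A i) (B i) \<noteq> 0" for i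
    using assms(2) by (cases "i \<in> I") auto
  have AB: "A i = B (i + 1)" for i
    using assms(1)[unfolded cut_def, rule_format, of i] by auto
  \<comment> \<open>Going outwards from \<open>e\<close>, \<open>B (i + 1) = A i = 0\<close>. A
    positive \<open>A (i + 1)\<close> would then make the factor at \<open>i + 1\<close> a binomial
    of the form \<open>n - 1\<close> over \<open>n\<close>, which is zero.\<close>
  have "A i = 0 \<and> B i = 0" if "e \<le> i" for i
    using that
  proof (induction i rule: int_ge_induct)
    case (step i)
    then show ?case
      using nz[of "i + 1"] AB[of i] gchoose_pred_0[of "A (i + 1)"]
      by (cases "A (i + 1) = 0") (auto simp: orders_def)
  qed (use assms in simp)
  moreover have "A i = 0 \<and> B i = 0" if "i \<le> e" for i
    using that
  proof (induction i rule: int_le_induct)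
    case (step i)
    then show ?case
      using nz[of "i - 1"] AB[of "i - 1"] gchoose_pred_0[of "B (i - 1)"]
      by (cases "B (i - 1) = 0") (auto simp: orders_def)
  qed (use assms in simp)
  ultimately show False
    using assms(6) by (meson linear)
qed

lemma Cons_in_walks_iff:
  "U # u \<in> walks A B s \<longleftrightarrow> 0 < A s \<and> u \<in> walks (A(s := A s - 1)) B (s + 1)"
  "D # u \<in> walks A B s \<longleftrightarrow> 0 < B s \<and> u \<in> walks A (B(s := B s - 1)) (s - 1)"
  by (auto simp: walks_def fun_eq_iff of_bool_def)

lemma walks_rec:
  assumes "A j \<noteq> 0 \<or> B j \<noteq> 0"
  shows "walks A B s =
    (if 0 < A s then (#) U ` walks (A(s := A s - 1)) B (s + 1) else {}) \<union>
    (if 0 < B s then (#) D ` walks A (B(s := B s - 1)) (s - 1) else {})"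
proof (rule set_eqI)
  fix u
  show "u \<in> walks A B s \<longleftrightarrow> u \<in>
    (if 0 < A s then (#) U ` walks (A(s := A s - 1)) B (s + 1) else {}) \<union>
    (if 0 < B s then (#) D ` walks A (B(s := B s - 1)) (s - 1) else {})"
  proof (cases u)
    case Nil
    then show ?thesis using assms by (auto simp: walks_def)
  next
    case (Cons x v)
    then show ?thesis by (cases x) (auto simp: Cons_in_walks_iff)
  qed
qed

lemma finite_card_walks:
  assumes "finite I" "\<And>i. A i \<noteq> 0 \<or> B i \<noteq> 0 \<Longrightarrow> i \<in> I" "cut A B s e"
  shows "finite (walks A B s) \<and> of_nat (card (walks A B s)) = (\<Prod>i\<in>I. orders e i (A i) (B i))"
  using assms(2,3)
proof (induction "\<Sum>i\<in>I. A i + B i" arbitrary: A B s)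
  case 0
  have "A i = 0 \<and> B i = 0" if "i \<in> I" for i
    using "0.hyps" [symmetric] assms(1) that by simp
  then have zero: "A i = 0 \<and> B i = 0" for i
    using "0.prems"(1)[of i] by blast
  have "u \<in> walks A B s \<longleftrightarrow> u = []" for u
  proof (cases u)
    case Nil
    then show ?thesis using zero by (auto simp: walks_def)
  next
    case (Cons x v)
    then show ?thesis using zero by (cases x) (simp_all add: Cons_in_walks_iff)
  qed
  then have walks: "walks A B s = {[]}" by blast
  show ?case unfolding walks using zero by simp
next
  case (Suc n)
  let ?A = "A(s := A s - 1)" and ?B = "B(s := B s - 1)"
  let ?P = "\<Prod>i\<in>I - {s}. orders e i (A i) (B i)"
  obtain j where j: "A j \<noteq> 0 \<or> B j \<noteq> 0"
  proof (rule ccontr)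
    assume "\<not> thesis"
    then have "A j = 0 \<and> B j = 0" for j
      using that by blast
    then show False
      using Suc.hyps(2) by simp
  qed
  have up: "finite (walks ?A B (s + 1)) \<and>
      of_nat (card (walks ?A B (s + 1))) = orders e s (A s - 1) (B s) * ?P" if "0 < A s"
  proof -
    have "s \<in> I" using Suc.prems(1)[of s] that by simp
    have sum: "n = (\<Sum>i\<in>I. ?A i + B i)"
      using Suc.hyps(2) that sum.remove[OF assms(1) \<open>s \<in> I\<close>, of "\<lambda>i. A i + B i"]
        sum.remove[OF assms(1) \<open>s \<in> I\<close>, of "\<lambda>i. ?A i + B i"] by simp
    have prod: "(\<Prod>i\<in>I. orders e i (?A i) (B i)) = orders e s (A s - 1) (B s) * ?P"
      using prod.remove[OF assms(1) \<open>s \<in> I\<close>, of "\<lambda>i. orders e i (?A i) (B i)"] by simp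
    have supp: "i \<in> I" if "?A i \<noteq> 0 \<or> B i \<noteq> 0" for i
      using that Suc.prems(1)[of i] by (auto split: if_splits)
    show ?thesis
      using Suc.hyps(1)[OF sum supp cut_up[OF Suc.prems(2) that]] unfolding prod .
  qed
  have down: "finite (walks A ?B (s - 1)) \<and>
      of_nat (card (walks A ?B (s - 1))) = orders e s (A s) (B s - 1) * ?P" if "0 < B s"
  proof -
    have "s \<in> I" using Suc.prems(1)[of s] that by simp
    have sum: "n = (\<Sum>i\<in>I. A i + ?B i)"
      using Suc.hyps(2) that sum.remove[OF assms(1) \<open>s \<in> I\<close>, of "\<lambda>i. A i + B i"]
        sum.remove[OF assms(1) \<open>s \<in> I\<close>, of "\<lambda>i. A i + ?B i"] by simp
    have prod: "(\<Prod>i\<in>I. orders e i (A i) (?B i)) = orders e s (A s) (B s - 1) * ?P"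
      using prod.remove[OF assms(1) \<open>s \<in> I\<close>, of "\<lambda>i. orders e i (A i) (?B i)"] by simp
    have supp: "i \<in> I" if "A i \<noteq> 0 \<or> ?B i \<noteq> 0" for i
      using that Suc.prems(1)[of i] by (auto split: if_splits)
    show ?thesis
      using Suc.hyps(1)[OF sum supp cut_down[OF Suc.prems(2) that]] unfolding prod .
  qed
  note rec = walks_rec[of A j B s, OF j]
  have fin: "finite (walks A B s)"
    unfolding rec using up down by auto
  have "card (walks A B s) =
      card (if 0 < A s then (#) U ` walks ?A B (s + 1) else {}) +
      card (if 0 < B s then (#) D ` walks A ?B (s - 1) else {})"
    unfolding rec by (rule card_Un_disjoint) (use up down in auto)
  also have "rat_of_nat \<dots> =
      ((if 0 < A s then orders e s (A s - 1) (B s) else 0) +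
       (if 0 < B s then orders e s (A s) (B s - 1) else 0)) * ?P"
    using up down by (simp add: card_image algebra_simps)
  finally have card: "of_nat (card (walks A B s)) =
      ((if 0 < A s then orders e s (A s - 1) (B s) else 0) +
       (if 0 < B s then orders e s (A s) (B s - 1) else 0)) * ?P" .
  have "of_nat (card (walks A B s)) = (\<Prod>i\<in>I. orders e i (A i) (B i))"
  \<comment> \<open>With no exit left at \<open>s\<close>, no walk exists; \<open>cut\<close> forces
    \<open>s = e\<close>, and the exits remaining at \<open>j\<close> make the product vanish as
    well.\<close>
  proof (cases "A s = 0 \<and> B s = 0")
    case True
    then have se: "s = e"
      using cut_start[OF Suc.prems(2)] True by (cases s e rule: linorder_cases) auto
    have "(\<Prod>i\<in>I. orders e i (A i) (B i)) = 0"
      by (rule prod_orders_stuck[of A B e I j]) (use se True Suc.prems j assms(1) in auto)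
    then show ?thesis
      using card True by simp
  next
    case False
    then have "s \<in> I" using Suc.prems(1)[of s] by auto
    show ?thesis
      unfolding card prod.remove[OF assms(1) \<open>s \<in> I\<close>]
      using orders_Pascal[of "A s" "B s" s e] cut_start[OF Suc.prems(2)] False by simp
  qed
  with fin show ?case by blast
qed

section \<open>From orders of exits to the binomials of the theorem\<close>

text \<open>The edge balance trades the coefficients at heights \<open>n\<close> and
  \<open>n + 2\<close> for the exit numbers at \<open>n + 1\<close>, and likewise on the negative
  side. Whether an edge lies between 0 and \<open>e\<close> decides the shift by one, hence the
  three cases of \<open>orders\<close>.\<close>

lemma side_factor_eq_orders:
  assumes "cut a b 0 e"
  shows "side_factor a b n = orders e (int n + 1) (a (int n + 1)) (b (int n + 1))
    * orders e (- int n - 1) (a (- int n - 1)) (b (- int n - 1))"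
proof -
  have right: "int (a i) = int (b (i + 1)) + of_bool (i < e)" if "0 \<le> i" for i
    using assms[unfolded cut_def, rule_format, of i] that by simp
  have left: "int (b i) = int (a (i - 1)) + of_bool (e < i)" if "i \<le> 0" for i
    using assms[unfolded cut_def, rule_format, of "i - 1"] that by simp
  have "((of_nat (a (int n)) + of_nat (b (int n + 2)) - 1) gchoose b (int n + 2))
      = orders e (int n + 1) (a (int n + 1)) (b (int n + 1))"
  proof -
    let ?p = "a (int n + 1)" and ?q = "b (int n + 1)"
    consider "int n + 1 < e" | "int n + 1 = e" | "e < int n + 1" by linarith
    then show ?thesis
    proof cases
      case 1
      then have "a (int n) = ?q + 1" "?p = b (int n + 2) + 1"
        using right[of "int n"] right[of "int n + 1"] by (auto simp: add.commute)
      with 1 show ?thesis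
        using gchoose_swap[of "b (int n + 2)" ?q] by (simp add: orders_def add.commute)
    next
      case 2
      then have "a (int n) = ?q + 1" "b (int n + 2) = ?p"
        using right[of "int n"] right[of "int n + 1"] by (auto simp: add.commute)
      with 2 show ?thesis by (simp add: orders_def add.commute)
    next
      case 3
      then have "a (int n) = ?q" "b (int n + 2) = ?p"
        using right[of "int n"] right[of "int n + 1"] by (auto simp: add.commute)
      with 3 show ?thesis by (simp add: orders_def add.commute)
    qed
  qed
  moreover have "((of_nat (b (- int n)) + of_nat (a (- int n - 2)) - 1) gchoose a (- int n - 2))
      = orders e (- int n - 1) (a (- int n - 1)) (b (- int n - 1))"
  proof -
    let ?p = "a (- int n - 1)" and ?q = "b (- int n - 1)"
    consider "- int n - 1 < e" | "- int n - 1 = e" | "e < - int n - 1" by linarith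
    then show ?thesis
    proof cases
      case 1
      then have "b (- int n) = ?p" "?q = a (- int n - 2)"
        using left[of "- int n"] left[of "- int n - 1"] by (auto simp: algebra_simps)
      with 1 show ?thesis by (simp add: orders_def add.commute)
    next
      case 2
      then have "b (- int n) = ?p + 1" "a (- int n - 2) = ?q"
        using left[of "- int n"] left[of "- int n - 1"] by (auto simp: algebra_simps)
      with 2 show ?thesis
        using gchoose_swap[of ?p ?q] by (simp add: orders_def add.commute)
    next
      case 3
      then have "b (- int n) = ?p + 1" "?q = a (- int n - 2) + 1"
        using left[of "- int n"] left[of "- int n - 1"] by (auto simp: algebra_simps)
      with 3 show ?thesis
        using gchoose_swap[of "a (- int n - 2)" ?p] by (simp add: orders_def add.commute)
    qed
  qed
  ultimately show ?thesis by (simp add: side_factor_def)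
qed

lemma prod_symmetric_interval:
  fixes f :: "int \<Rightarrow> 'a :: comm_monoid_mult"
  shows "(\<Prod>i\<in>{- int N..int N}. f i) = f 0 * (\<Prod>n<N. f (int n + 1) * f (- int n - 1))"
proof (induction N)
  case (Suc N)
  have "{- int (Suc N)..int (Suc N)} = insert (int N + 1) (insert (- int N - 1) {- int N..int N})"
    by auto
  then show ?case
    using Suc.IH by (simp add: mult_ac)
qed simp

theorem theorem6p14:
  fixes w :: word and a b :: "int \<Rightarrow> nat"
  assumes "a = Poly_Mapping.lookup (H_NE w)" and "b = Poly_Mapping.lookup (H_SE w)"
  shows "of_nat (card {u. u \<sim>bal w}) =
    Prod_any (side_factor a b) *
    (if balanced w then (of_nat (a 0) + of_nat (b 0)) gchoose a 0
     else if rising w then (of_nat (a 0) + of_nat (b 0) - 1) gchoose b 0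
     else (of_nat (a 0) + of_nat (b 0) - 1) gchoose a 0)"
proof -
  define e where "e = rise w"
  have a: "a = exits U 0 w" and b: "b = exits D 0 w"
    using assms lookup_H_NE lookup_H_SE by simp_all
  have cut: "cut a b 0 e"
    using cut_exits[of 0 w] by (simp add: a b e_def)
  have "{u. u \<sim>bal w} = walks a b 0"
  proof (intro set_eqI iffI)
    fix u assume "u \<in> walks a b 0"
    then have "exits c 0 u = exits c 0 w" for c
      by (cases c) (auto simp: walks_def a b)
    then show "u \<in> {u. u \<sim>bal w}"
      using bal_equiv_if_exits_eq by blast
  qed (auto simp: walks_def a b dest: exits_bal_equiv)
  \<comment> \<open>The sum of the absolute values of all heights in the support serves as a crude
    bound.\<close>
  obtain N where N: "\<And>i. a i \<noteq> 0 \<or> b i \<noteq> 0 \<Longrightarrow> i \<in> {- int N..int N}"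
  proof -
    let ?S = "{i. a i \<noteq> 0} \<union> {i. b i \<noteq> 0}"
    have "finite ?S"
      unfolding a b by (intro finite_UnI finite_exits)
    then have "i \<in> {- int (nat (\<Sum>j\<in>?S. \<bar>j\<bar>))..int (nat (\<Sum>j\<in>?S. \<bar>j\<bar>))}" if "i \<in> ?S" for i
      using member_le_sum[OF that, of abs] by (auto simp: abs_le_iff)
    then show ?thesis
      using that by blast
  qed
  \<comment> \<open>Factor \<open>n\<close> belongs to the heights \<open>n + 1\<close> and
    \<open>- n - 1\<close>, which for \<open>n \<ge> N\<close> have no exits and contribute
    1.\<close>
  have "Prod_any (side_factor a b) = prod (side_factor a b) {..<N}"
  proof (rule Prod_any.expand_superset)
    show "{n. side_factor a b n \<noteq> 1} \<subseteq> {..<N}"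
    proof (rule subsetI, rule ccontr)
      fix n assume *: "n \<in> {n. side_factor a b n \<noteq> 1}" "n \<notin> {..<N}"
      then have "int n + 1 \<notin> {- int N..int N}" "- int n - 1 \<notin> {- int N..int N}"
        by auto
      then have "a (int n + 1) = 0" "b (int n + 1) = 0" "a (- int n - 1) = 0" "b (- int n - 1) = 0"
        using N by blast+
      with * show False by (simp add: side_factor_eq_orders[OF cut])
    qed
  qed simp
  then have "of_nat (card {u. u \<sim>bal w}) = Prod_any (side_factor a b) * orders e 0 (a 0) (b 0)"
    using finite_card_walks[of "{- int N..int N}" a b 0 e] N cut \<open>{u. u \<sim>bal w} = walks a b 0\<close>
    by (simp add: prod_symmetric_interval side_factor_eq_orders[OF cut])
  \<comment> \<open>The factor at the start height 0 remains; its cases \<open>0 = e\<close>,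
    \<open>0 < e\<close>, \<open>e < 0\<close> are balanced, rising and falling.\<close>
  then show ?thesis
    by (auto simp: orders_def e_def balanced_iff_rise rising_iff_rise)
qed

end
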